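(* Let $(\theta_k)$ be a sequence in $(0,1)$ with $\theta_k\to1^-$ and let $\mathcal F$ be a free ultrafilter on $\mathbb N$. Let $S=\{f_{\mathcal G}:\mathcal G\in\beta\mathbb N^*\}$, where $f_{\mathcal G}:\ell_\infty\to\mathbb R$ is given by $f_{\mathcal G}(x)=\mathcal F\text{-}\lim_k\ \mathcal G\text{-}\lim_n\ \Theta_{\theta_k,n}(x)$, and regard $S$ as a subset of $\ell_\infty^*$ with the weak$^*$ topology. Then the weak$^*$-closed convex hull of $S$ equals $\mathrm{Ces}^+$, the set of all positive continuous linear functionals on $\ell_\infty$ extending the Ces\`aro mean. Equivalently, the weak$^*$ closure $\overline S$ contains all extreme points of $\mathrm{Ces}^+$.
   Context: For $\theta\in(0,1)$, $n\in\mathbb N$ and bounded $x$, $\Theta_{\theta,n}(x)=\frac{\sum_i x_i\chi_{(\theta n,n]}(i)}{n(1-\theta)}$. For an ultrafilter $\mathcal F$ on $\mathbb N$ and a bounded real sequence $(y_n)$, $\mathcal F\text{-}\lim y_n$ is the unique $L$ with $\{n:|y_n-L|<\varepsilon\}\in\mathcal F$ for all $\varepsilon>0$; $\beta\mathbb N^*$ is the set of free ultrafilters on $\mathbb N$. $C(x)=\lim_n(x_1+\dots+x_n)/n$ is the Ces\`aro mean when it exists, $\mathrm{Ces}$ the set of bounded sequences having one, and $\mathrm{Ces}^+=\{f\in\ell_\infty^*: f\ge0,\ f|_{\mathrm{Ces}}=C\}$. *)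

theory Defs
  imports "HOL-Analysis.Analysis"
begin

text \<open>
  Since every function on the discrete space \<^typ>\<open>nat\<close> is continuous, bounded continuous
  functions from \<^typ>\<open>nat\<close> to \<^typ>\<open>real\<close> are exactly the bounded real sequences, with
  the supremum norm.
\<close>

type_synonym linfty = "nat \<Rightarrow>\<^sub>C real"

type_synonym linfty_dual = "linfty \<Rightarrow>\<^sub>L real"

text \<open>
  Sequences are written \<open>x\<^sub>1, x\<^sub>2, \<dots>\<close>, whereas \<^typ>\<open>nat\<close> starts at \<open>0\<close>: the entry
  \<open>x\<^sub>i\<close> is stored at position \<open>i - 1\<close>.  Only indices \<open>i \<ge> 1\<close> are ever used.
\<close>

definition entry :: "linfty \<Rightarrow> nat \<Rightarrow> real" where
  "entry x i = apply_bcontfun x (i - 1)"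

text \<open>
  For scalar-valued operators the strong operator topology is the topology of pointwise
  convergence on \<^typ>\<open>linfty\<close>, which is the weak-star topology.
\<close>

abbreviation weak_star :: "linfty_dual topology" where
  "weak_star \<equiv> strong_operator_topology"

definition Cesaro_avg :: "linfty \<Rightarrow> nat \<Rightarrow> real" where
  "Cesaro_avg x n = (\<Sum>i=1..n. entry x i) / real n"

definition Ces :: "linfty set" where
  "Ces = {x. convergent (Cesaro_avg x)}"

definition Cesaro_mean :: "linfty \<Rightarrow> real" where
  "Cesaro_mean x = lim (Cesaro_avg x)"

definition Ces_plus :: "linfty_dual set" where
  "Ces_plus = {f. (\<forall>x. (\<forall>i\<ge>1. 0 \<le> entry x i) \<longrightarrow> 0 \<le> blinfun_apply f x) \<and>
                  (\<forall>x\<in>Ces. blinfun_apply f x = Cesaro_mean x)}"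

definition Theta :: "real \<Rightarrow> nat \<Rightarrow> linfty \<Rightarrow> real" where
  "Theta \<theta> n x = (\<Sum>i | real i \<in> {\<theta> * real n<..real n}. entry x i) / (real n * (1 - \<theta>))"

text \<open>A set of natural numbers belongs to a filter iff membership in it holds eventually.\<close>

definition free_ultrafilter :: "nat filter \<Rightarrow> bool" where
  "free_ultrafilter F \<longleftrightarrow> F \<noteq> bot \<and>
     (\<forall>P. eventually P F \<or> eventually (\<lambda>n. \<not> P n) F) \<and>
     (\<forall>P. eventually P F \<longrightarrow> infinite {n. P n})"

text \<open>
  The limit of a bounded real sequence along an ultrafilter is the library's \<^const>\<open>Lim\<close>;
  existence is \<open>free_ultrafilter_Lim\<close> below.
\<close>

definition f_fun :: "(nat \<Rightarrow> real) \<Rightarrow> nat filter \<Rightarrow> nat filter \<Rightarrow> linfty \<Rightarrow> real" where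
  "f_fun \<theta> F G x = Lim F (\<lambda>k. Lim G (\<lambda>n. Theta (\<theta> k) n x))"

text \<open>
  \<^const>\<open>Blinfun\<close> is meaningful here because \<^const>\<open>f_fun\<close> is bounded linear for free
  ultrafilters; see \<open>bounded_linear_f_fun\<close> below.
\<close>

definition S_set :: "(nat \<Rightarrow> real) \<Rightarrow> nat filter \<Rightarrow> linfty_dual set" where
  "S_set \<theta> F = (\<lambda>G. Blinfun (f_fun \<theta> F G)) ` {G. free_ultrafilter G}"

lemma free_ultrafilter_Lim:
  fixes y :: "nat \<Rightarrow> real"
  assumes F: "free_ultrafilter F" and b: "\<And>n. \<bar>y n\<bar> \<le> B"
  shows "(y \<longlongrightarrow> Lim F y) F" "\<bar>Lim F y\<bar> \<le> B"
proof -
  have nb: "F \<noteq> bot" and ul: "\<And>P. eventually P F \<or> eventually (\<lambda>n. \<not> P n) F"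
    using F by (auto simp: free_ultrafilter_def)
  have "compact {-B..B}" by simp
  moreover have "filtermap y F \<noteq> bot" using nb by (simp add: filtermap_bot_iff)
  moreover have "eventually (\<lambda>z. z \<in> {-B..B}) (filtermap y F)"
  proof -
    have "y n \<in> {-B..B}" for n using b[of n] by (auto simp: abs_le_iff)
    then show ?thesis by (simp add: eventually_filtermap)
  qed
  ultimately obtain L where L: "L \<in> {-B..B}" "inf (nhds L) (filtermap y F) \<noteq> bot"
    unfolding compact_filter by blast
  have lim: "(y \<longlongrightarrow> L) F"
  proof (rule topological_tendstoI)
    fix U assume U: "open U" "L \<in> U"
    show "eventually (\<lambda>n. y n \<in> U) F"
    proof (rule ccontr)
      assume "\<not> eventually (\<lambda>n. y n \<in> U) F"
      then have "eventually (\<lambda>n. y n \<notin> U) F" using ul[of "\<lambda>n. y n \<in> U"] by auto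
      then have "eventually (\<lambda>z. z \<notin> U) (filtermap y F)" by (simp add: eventually_filtermap)
      moreover have "eventually (\<lambda>z. z \<in> U) (nhds L)" using U by (simp add: eventually_nhds_in_open)
      ultimately have "eventually (\<lambda>z. False) (inf (nhds L) (filtermap y F))"
        unfolding eventually_inf by blast
      then show False using L(2) by (simp add: trivial_limit_def)
    qed
  qed
  have "Lim F y = L" using tendsto_Lim[OF _ lim] nb by simp
  then show "(y \<longlongrightarrow> Lim F y) F" "\<bar>Lim F y\<bar> \<le> B" using lim L(1) by auto
qed

lemma abs_Theta_le:
  assumes "0 < \<theta>" "\<theta> < 1"
  shows "\<bar>Theta \<theta> n x\<bar> \<le> norm x * (1 / (1 - \<theta>))"
proof (cases "n = 0")
  case True
  then show ?thesis using assms by (simp add: Theta_def)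
next
  case False
  let ?I = "{i. real i \<in> {\<theta> * real n<..real n}}"
  have sub: "?I \<subseteq> {1..n}"
  proof
    fix i assume "i \<in> ?I"
    then have "\<theta> * real n < real i" "i \<le> n" by auto
    moreover have "0 \<le> \<theta> * real n" using assms by simp
    ultimately have "0 < real i" by linarith
    then show "i \<in> {1..n}" using \<open>i \<le> n\<close> by simp
  qed
  have "card ?I \<le> n" using card_mono[OF _ sub] by simp
  have "\<bar>\<Sum>i\<in>?I. entry x i\<bar> \<le> (\<Sum>i\<in>?I. \<bar>entry x i\<bar>)" by (rule sum_abs)
  also have "\<dots> \<le> real (card ?I) * norm x"
    by (rule sum_bounded_above) (metis entry_def norm_bounded real_norm_def)
  also have "\<dots> \<le> real n * norm x" using \<open>card ?I \<le> n\<close> by (intro mult_right_mono) auto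
  finally have "\<bar>\<Sum>i\<in>?I. entry x i\<bar> \<le> real n * norm x" .
  then have "\<bar>\<Sum>i\<in>?I. entry x i\<bar> / (real n * (1 - \<theta>)) \<le> real n * norm x / (real n * (1 - \<theta>))"
    using assms by (intro divide_right_mono) auto
  then show ?thesis using False assms by (simp add: Theta_def abs_mult)
qed

lemma Theta_add: "Theta \<theta> n (x + y) = Theta \<theta> n x + Theta \<theta> n y"
  by (simp add: Theta_def entry_def plus_bcontfun.rep_eq sum.distrib add_divide_distrib)

lemma Theta_scaleR: "Theta \<theta> n (r *\<^sub>R x) = r * Theta \<theta> n x"
  by (simp add: Theta_def entry_def scaleR_bcontfun.rep_eq sum_distrib_left[symmetric])

lemma abs_Theta_le_sharp:
  assumes "0 < \<theta>" "\<theta> < 1" "n > 0"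
  shows "\<bar>Theta \<theta> n x\<bar> \<le> norm x * (1 + (1 / (1 - \<theta>)) / real n)"
proof -
  let ?I = "{i. real i \<in> {\<theta> * real n<..real n}}"
  let ?m = "nat \<lfloor>\<theta> * real n\<rfloor>"
  have m: "real ?m \<le> \<theta> * real n" "\<theta> * real n < real ?m + 1"
    using assms by (simp_all add: floor_less_cancel)
  have "real ?m \<le> real n" using m(1) assms by (smt (verit) mult_left_le_one_le of_nat_0_le_iff)
  have "?I \<subseteq> {?m<..n}" using m(1) by auto
  then have "card ?I \<le> n - ?m" using card_mono[of "{?m<..n}" ?I] by simp
  then have c: "real (card ?I) \<le> real n * (1 - \<theta>) + 1"
    using m \<open>real ?m \<le> real n\<close> by (simp add: algebra_simps of_nat_diff)
  have "\<bar>\<Sum>i\<in>?I. entry x i\<bar> \<le> (\<Sum>i\<in>?I. \<bar>entry x i\<bar>)" by (rule sum_abs)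
  also have "\<dots> \<le> real (card ?I) * norm x"
    by (rule sum_bounded_above) (metis entry_def norm_bounded real_norm_def)
  also have "\<dots> \<le> (real n * (1 - \<theta>) + 1) * norm x" using c by (intro mult_right_mono) auto
  finally have "\<bar>\<Sum>i\<in>?I. entry x i\<bar> / (real n * (1 - \<theta>))
      \<le> (real n * (1 - \<theta>) + 1) * norm x / (real n * (1 - \<theta>))"
    using assms by (intro divide_right_mono) auto
  also have "\<dots> = norm x * (1 + (1 / (1 - \<theta>)) / real n)"
    using assms by (simp add: field_simps)
  finally show ?thesis using assms by (simp add: Theta_def abs_mult)
qed

lemma free_ultrafilter_le_sequentially:
  assumes "free_ultrafilter F" shows "F \<le> sequentially"
proof (rule filter_leI)
  fix P :: "nat \<Rightarrow> bool" assume "eventually P sequentially"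
  then obtain N where N: "\<And>n. n \<ge> N \<Longrightarrow> P n" by (auto simp: eventually_sequentially)
  have "finite {n. \<not> P n}"
    by (rule finite_subset[of _ "{..<N}"]) (use N not_le in auto)
  then show "eventually P F" using assms unfolding free_ultrafilter_def by blast
qed

lemma Theta_Lim:
  assumes "0 < \<theta>" "\<theta> < 1" and G: "free_ultrafilter G"
  shows "((\<lambda>n. Theta \<theta> n x) \<longlongrightarrow> Lim G (\<lambda>n. Theta \<theta> n x)) G"
    and "\<bar>Lim G (\<lambda>n. Theta \<theta> n x)\<bar> \<le> norm x"
proof -
  show lim: "((\<lambda>n. Theta \<theta> n x) \<longlongrightarrow> Lim G (\<lambda>n. Theta \<theta> n x)) G"
    using free_ultrafilter_Lim(1)[OF G abs_Theta_le[OF assms(1,2)]] .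
  have nb: "G \<noteq> bot" using G by (simp add: free_ultrafilter_def)
  have "(\<lambda>n. norm x * (1 + (1 / (1 - \<theta>)) / real n)) \<longlonglongrightarrow> norm x * (1 + 0)"
    by (intro tendsto_intros lim_const_over_n)
  then have B: "((\<lambda>n. norm x * (1 + (1 / (1 - \<theta>)) / real n)) \<longlongrightarrow> norm x) G"
    using tendsto_mono[OF free_ultrafilter_le_sequentially[OF G]] by simp
  have "eventually (\<lambda>n. 0 < n) sequentially" by (rule eventually_gt_at_top)
  then have "eventually (\<lambda>n. 0 < n) G"
    using free_ultrafilter_le_sequentially[OF G] by (rule filter_leD[rotated])
  then have "eventually (\<lambda>n. \<bar>Theta \<theta> n x\<bar> \<le> norm x * (1 + (1 / (1 - \<theta>)) / real n)) G"
    by eventually_elim (use abs_Theta_le_sharp assms in auto)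
  then show "\<bar>Lim G (\<lambda>n. Theta \<theta> n x)\<bar> \<le> norm x"
    using tendsto_le[OF nb B tendsto_rabs[OF lim]] by simp
qed

lemma bounded_linear_f_fun:
  assumes \<theta>: "\<And>k. 0 < \<theta> k \<and> \<theta> k < 1"
    and F: "free_ultrafilter F" and G: "free_ultrafilter G"
  shows "bounded_linear (f_fun \<theta> F G)"
proof -
  let ?g = "\<lambda>k x. Lim G (\<lambda>n. Theta (\<theta> k) n x)"
  have nF: "F \<noteq> bot" and nG: "G \<noteq> bot" using F G by (simp_all add: free_ultrafilter_def)
  have g: "((\<lambda>n. Theta (\<theta> k) n x) \<longlongrightarrow> ?g k x) G" "\<bar>?g k x\<bar> \<le> norm x" for k x
    using Theta_Lim[OF _ _ G] \<theta> by auto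
  have f: "((\<lambda>k. ?g k x) \<longlongrightarrow> f_fun \<theta> F G x) F" "\<bar>f_fun \<theta> F G x\<bar> \<le> norm x" for x
    unfolding f_fun_def using free_ultrafilter_Lim[OF F g(2)] by auto
  have gadd: "?g k (x + y) = ?g k x + ?g k y" for k x y
    using tendsto_Lim[OF nG tendsto_add[OF g(1) g(1)]] by (simp add: Theta_add)
  have gscale: "?g k (r *\<^sub>R x) = r * ?g k x" for k r x
    using tendsto_Lim[OF nG tendsto_mult_left[OF g(1)]] by (simp add: Theta_scaleR)
  show ?thesis
  proof (rule bounded_linear_intro)
    fix x y r
    show "f_fun \<theta> F G (x + y) = f_fun \<theta> F G x + f_fun \<theta> F G y"
      unfolding f_fun_def[of _ _ _ "x + y"] gadd by (rule tendsto_Lim[OF nF tendsto_add[OF f(1) f(1)]])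
    show "f_fun \<theta> F G (r *\<^sub>R x) = r *\<^sub>R f_fun \<theta> F G x"
      unfolding f_fun_def[of _ _ _ "r *\<^sub>R x"] gscale real_scaleR_def
      by (rule tendsto_Lim[OF nF tendsto_mult_left[OF f(1)]])
    show "norm (f_fun \<theta> F G x) \<le> norm x * 1" using f(2) by simp
  qed
qed

end

theory Submission
  imports Defs
begin

text \<open>
  The core is that \<open>f(x) \<le> sup\<^sub>G f\<^sub>G(x)\<close> for every \<open>f \<in> Ces\<^sup>+\<close>.  Let \<open>q\<close> exceed this supremum and put
  \<open>H(m) = \<Sum>\<^bsub>i\<le>m\<^esub> (x\<^sub>i - q)\<close>.  If for some \<open>t < 1\<close> there were infinitely many \<open>m\<close> at which \<open>H\<close>
  attains its maximum over \<open>[t m - 1, m]\<close>, then along a free ultrafilter \<open>G\<close> concentrated on these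
  \<open>m\<close> all averages \<open>\<Theta>\<^bsub>\<theta>,m\<^esub>(x)\<close> with \<open>\<theta> \<ge> t\<close> would be at least \<open>q\<close> in the limit, simultaneously for
  all such \<open>\<theta>\<close>, so \<open>f\<^sub>G(x) \<ge> q\<close>.  Hence every large \<open>m\<close> has a nearby predecessor with larger \<open>H\<close>,
  which makes \<open>H\<close> decreasing up to an error \<open>o(m)\<close>, and \<open>f(x) \<le> q\<close> follows.

  Weak-star neighbourhoods involve finitely many coordinates, so separating \<open>f\<close> from the convex hull
  of \<open>S\<close> takes no more than an almost nearest point in those coordinates.  The statement on extreme
  points is Milman's converse to the Krein--Milman theorem.
\<close>

section \<open>Free ultrafilters containing a given infinite set\<close>

text \<open>Zorn's lemma gives a maximal family containing \<open>A\<close> all of whose finite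
  intersections are infinite. Asking for infinite rather than nonempty intersections makes the
  generated filter free; maximality makes it an ultrafilter.\<close>

lemma ex_free_ultrafilter_containing:
  fixes A :: "nat set"
  assumes "infinite A"
  obtains G where "free_ultrafilter G" "eventually (\<lambda>n. n \<in> A) G"
proof -
  define FIP where "FIP = {\<U> :: nat set set. A \<in> \<U> \<and> (\<forall>\<H> \<subseteq> \<U>. finite \<H> \<longrightarrow> infinite (\<Inter>\<H>))}"
  have "infinite (\<Inter>\<H>)" if "\<H> \<subseteq> {A}" for \<H>
    using subset_singletonD[OF that] assms by auto
  then have "{A} \<in> FIP" by (auto simp: FIP_def)
  then have "FIP \<noteq> {}" by blast
  moreover have "\<Union>\<C> \<in> FIP" if C: "\<C> \<noteq> {}" "subset.chain FIP \<C>" for \<C>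
  proof -
    have "infinite (\<Inter>\<H>)" if \<H>: "\<H> \<subseteq> \<Union>\<C>" "finite \<H>" for \<H>
    proof -
      obtain \<U> where "\<U> \<in> \<C>" "\<H> \<subseteq> \<U>"
        using finite_subset_Union_chain[OF \<H>(2,1) C] by blast
      then show ?thesis using C(2) \<H>(2) by (auto simp: subset_chain_def FIP_def)
    qed
    then show ?thesis using C by (auto simp: subset_chain_def FIP_def)
  qed
  ultimately have "\<exists>M\<in>FIP. \<forall>X\<in>FIP. M \<subseteq> X \<longrightarrow> X = M" by (rule subset_Zorn_nonempty)
  then obtain \<U> where \<U>: "\<U> \<in> FIP" and max: "\<And>\<V>. \<V> \<in> FIP \<Longrightarrow> \<U> \<subseteq> \<V> \<Longrightarrow> \<V> = \<U>"
    by blast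
  have fip: "infinite (\<Inter>\<H>)" if "\<H> \<subseteq> \<U>" "finite \<H>" for \<H>
    using \<U> that by (auto simp: FIP_def)
  \<comment> \<open>By maximality \<open>Q\<close> cannot be added, so some finite subfamily has an
    intersection that meets \<open>Q\<close> in a finite set only.\<close>
  have split: "\<exists>\<H> \<subseteq> \<U>. finite \<H> \<and> finite (Q \<inter> \<Inter>\<H>)" if "Q \<notin> \<U>" for Q
  proof (rule ccontr)
    assume *: "\<not> ?thesis"
    have "infinite (\<Inter>\<H>)" if "\<H> \<subseteq> insert Q \<U>" "finite \<H>" for \<H>
    proof -
      have "infinite (Q \<inter> \<Inter>(\<H> - {Q}))"
      proof -
        have "\<H> - {Q} \<subseteq> \<U>" "finite (\<H> - {Q})" using that by auto
        then show ?thesis using * by blast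
      qed
      moreover have "Q \<inter> \<Inter>(\<H> - {Q}) \<subseteq> \<Inter>\<H>" by auto
      ultimately show ?thesis by (rule infinite_super[rotated])
    qed
    then have "insert Q \<U> \<in> FIP" using \<U> by (auto simp: FIP_def)
    then show False using max[of "insert Q \<U>"] \<open>Q \<notin> \<U>\<close> by blast
  qed
  \<comment> \<open>If both \<open>Q\<close> and its complement were missing, the two subfamilies
    from \<open>split\<close> together would have a finite intersection.\<close>
  have dich: "Q \<in> \<U> \<or> - Q \<in> \<U>" for Q
  proof (rule ccontr)
    assume "\<not> ?thesis"
    then obtain \<H>\<^sub>1 \<H>\<^sub>2 where "\<H>\<^sub>1 \<subseteq> \<U>" "finite \<H>\<^sub>1" "finite (Q \<inter> \<Inter>\<H>\<^sub>1)"
      "\<H>\<^sub>2 \<subseteq> \<U>" "finite \<H>\<^sub>2" "finite (- Q \<inter> \<Inter>\<H>\<^sub>2)"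
      using split by meson
    then have *: "finite ((Q \<inter> \<Inter>\<H>\<^sub>1) \<union> (- Q \<inter> \<Inter>\<H>\<^sub>2))"
      and "infinite (\<Inter>(\<H>\<^sub>1 \<union> \<H>\<^sub>2))"
      by (blast, intro fip) auto
    moreover have "\<Inter>(\<H>\<^sub>1 \<union> \<H>\<^sub>2) \<subseteq> (Q \<inter> \<Inter>\<H>\<^sub>1) \<union> (- Q \<inter> \<Inter>\<H>\<^sub>2)" by auto
    ultimately show False using finite_subset by metis
  qed
  define G where "G = (INF U\<in>\<U>. principal U)"
  have mem: "eventually (\<lambda>n. n \<in> U) G" if "U \<in> \<U>" for U
    unfolding G_def by (rule eventually_INF1[OF that]) (simp add: eventually_principal)
  \<comment> \<open>An event of \<open>G\<close> already follows from finitely many members of the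
    family.\<close>
  have inf: "infinite {n. P n}" if ev: "eventually P G" for P
  proof -
    obtain \<H> where \<H>: "\<H> \<subseteq> \<U>" "finite \<H>" "eventually P (INF U\<in>\<H>. principal U)"
      using iffD1[OF eventually_INF ev[unfolded G_def]] by (elim exE conjE)
    then have "\<Inter>\<H> \<subseteq> {n. P n}"
      by (auto simp: INF_principal_finite eventually_principal)
    then show ?thesis using fip[OF \<H>(1,2)] by (rule infinite_super)
  qed
  have "free_ultrafilter G"
    unfolding free_ultrafilter_def
  proof (intro conjI allI impI)
    show "G \<noteq> bot" using inf[of "\<lambda>_. False"] by (auto simp: trivial_limit_def)
    show "eventually P G \<or> eventually (\<lambda>n. \<not> P n) G" for P
      using dich[of "{n. P n}"] mem[of "{n. P n}"] mem[of "- {n. P n}"] by auto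
  qed (rule inf)
  moreover have "eventually (\<lambda>n. n \<in> A) G" using mem \<U> by (auto simp: FIP_def)
  ultimately show thesis using that by blast
qed

section \<open>Prefix sums, and membership of the functionals of S in
  \<open>Ces_plus\<close>\<close>

text \<open>Positions \<open>p < n\<close> hold the entries 1 to n, so the index shift of
  \<open>entry\<close> disappears. Both kinds of averages become quotients of these sums.\<close>

definition prefix_sum :: "linfty \<Rightarrow> nat \<Rightarrow> real" where
  "prefix_sum x n = (\<Sum>p<n. apply_bcontfun x p)"

lemma prefix_sum_0 [simp]: "prefix_sum x 0 = 0"
  by (simp add: prefix_sum_def)

lemma prefix_sum_Suc [simp]: "prefix_sum x (Suc n) = prefix_sum x n + apply_bcontfun x n"
  by (simp add: prefix_sum_def)

lemma sum_entry: "(\<Sum>i=1..n. entry x i) = prefix_sum x n"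
  by (simp add: prefix_sum_def entry_def sum.atLeast1_atMost_eq)

lemma Cesaro_avg_eq: "Cesaro_avg x n = prefix_sum x n / real n"
  by (simp only: Cesaro_avg_def sum_entry)

lemma prefix_sum_eq: "prefix_sum x n = real n * Cesaro_avg x n"
  by (simp add: Cesaro_avg_eq)

lemma Theta_eq_prefix_sum:
  assumes "0 < \<theta>" "\<theta> < 1"
  shows "Theta \<theta> n x = (prefix_sum x n - prefix_sum x (nat \<lfloor>\<theta> * real n\<rfloor>)) / (real n * (1 - \<theta>))"
proof -
  let ?m = "nat \<lfloor>\<theta> * real n\<rfloor>"
  have "real ?m \<le> \<theta> * real n" using assms by simp
  also have "\<dots> \<le> real n" using assms by (simp add: mult_left_le_one_le)
  finally have le: "?m \<le> n" by simp
  have "{i. real i \<in> {\<theta> * real n<..real n}} = {1..n} - {1..?m}"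
  proof -
    have "\<theta> * real n < real i \<longleftrightarrow> ?m < i" for i
      using assms by (simp add: nat_less_iff floor_less_iff)
    then have "{i. real i \<in> {\<theta> * real n<..real n}} = {?m<..n}"
      by (simp add: greaterThanAtMost_def greaterThan_def atMost_def Collect_conj_eq)
    also have "\<dots> = {1..n} - {1..?m}" by auto
    finally show ?thesis .
  qed
  then have "(\<Sum>i | real i \<in> {\<theta> * real n<..real n}. entry x i)
      = (\<Sum>i=1..n. entry x i) - (\<Sum>i=1..?m. entry x i)"
    using le by (simp add: sum_diff)
  then show ?thesis by (simp only: Theta_def sum_entry)
qed

text \<open>With m the floor of \<theta>n, \<open>Theta\<close> equals (avg_n - (m/n) avg_m) / (1 -
  \<theta>). Both averages tend to the mean c and m/n tends to \<theta>, so the limit is (c -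
  \<theta>c) / (1 - \<theta>) = c.\<close>

lemma Theta_tendsto_Cesaro_mean:
  assumes "0 < \<theta>" "\<theta> < 1" and x: "x \<in> Ces"
  shows "(\<lambda>n. Theta \<theta> n x) \<longlonglongrightarrow> Cesaro_mean x"
proof -
  let ?m = "\<lambda>n. nat \<lfloor>\<theta> * real n\<rfloor>" and ?c = "Cesaro_mean x"
  have lim: "Cesaro_avg x \<longlonglongrightarrow> ?c"
    using x by (simp add: Ces_def Cesaro_mean_def convergent_LIMSEQ_iff)
  have ratio: "(\<lambda>n. real (?m n) / real n) \<longlonglongrightarrow> \<theta>"
  proof (rule real_tendsto_sandwich)
    show "\<forall>\<^sub>F n in sequentially. \<theta> - 1 / real n \<le> real (?m n) / real n"
      using eventually_gt_at_top[of 0]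
    proof eventually_elim
      case (elim n)
      then have "(\<theta> * real n - 1) / real n \<le> real (?m n) / real n"
        using assms by (intro divide_right_mono) linarith+
      then show ?case using elim by (simp add: diff_divide_distrib)
    qed
    show "\<forall>\<^sub>F n in sequentially. real (?m n) / real n \<le> \<theta>"
      using eventually_gt_at_top[of 0]
    proof eventually_elim
      case (elim n)
      then have "real (?m n) \<le> \<theta> * real n" using assms by simp
      then show ?case using elim by (simp add: field_simps)
    qed
    show "(\<lambda>n. \<theta> - 1 / real n) \<longlonglongrightarrow> \<theta>"
      using tendsto_diff[OF tendsto_const lim_const_over_n] by fastforce
  qed simp
  have "filterlim (\<lambda>n. \<theta> * real n) at_top sequentially"
    using assms by (intro filterlim_tendsto_pos_mult_at_top[OF tendsto_const]
        filterlim_real_sequentially) auto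
  then have "filterlim ?m sequentially sequentially"
    by (intro filterlim_compose[OF filterlim_nat_sequentially]
        filterlim_compose[OF filterlim_floor_sequentially])
  then have "(\<lambda>n. Cesaro_avg x (?m n)) \<longlonglongrightarrow> ?c" by (rule filterlim_compose[OF lim])
  then have "(\<lambda>n. (Cesaro_avg x n - real (?m n) / real n * Cesaro_avg x (?m n)) / (1 - \<theta>))
      \<longlonglongrightarrow> (?c - \<theta> * ?c) / (1 - \<theta>)"
    using assms by (intro tendsto_intros lim ratio) auto
  also have "(?c - \<theta> * ?c) / (1 - \<theta>) = ?c" using assms by (simp add: field_simps)
  finally show ?thesis
  proof (rule Lim_transform_eventually)
    show "\<forall>\<^sub>F n in sequentially.
        (Cesaro_avg x n - real (?m n) / real n * Cesaro_avg x (?m n)) / (1 - \<theta>) = Theta \<theta> n x"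
      using eventually_gt_at_top[of 0]
    proof eventually_elim
      case (elim n)
      have "prefix_sum x n - prefix_sum x (?m n)
          = real n * (Cesaro_avg x n - real (?m n) / real n * Cesaro_avg x (?m n))"
        using elim by (simp add: prefix_sum_eq[of x] right_diff_distrib)
      then show ?case using elim assms(1,2) by (simp add: Theta_eq_prefix_sum)
    qed
  qed
qed

lemma Theta_nonneg:
  assumes "0 < \<theta>" "\<theta> < 1" and "\<And>i. i \<ge> 1 \<Longrightarrow> 0 \<le> entry x i"
  shows "0 \<le> Theta \<theta> n x"
proof -
  have "0 \<le> entry x i" if "\<theta> * real n < real i" for i
  proof -
    have "0 \<le> \<theta> * real n" using assms by simp
    with that have "0 < real i" by linarith
    then show ?thesis using assms(3)[of i] by simp
  qed
  then show ?thesis using assms unfolding Theta_def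
    by (intro divide_nonneg_nonneg sum_nonneg mult_nonneg_nonneg) auto
qed

lemma f_fun_tendsto:
  assumes "\<And>k. 0 < \<theta> k \<and> \<theta> k < 1" "free_ultrafilter F" "free_ultrafilter G"
  shows "((\<lambda>k. Lim G (\<lambda>n. Theta (\<theta> k) n x)) \<longlongrightarrow> f_fun \<theta> F G x) F"
  unfolding f_fun_def
  by (rule free_ultrafilter_Lim(1)[OF assms(2) Theta_Lim(2)[OF _ _ assms(3)]]) (use assms in auto)

text \<open>Positivity passes through both limits. On \<open>Ces\<close> the inner limit is the
  Cesaro mean for every k, since a free ultrafilter refines \<open>sequentially\<close>; the outer
  limit is then that of a constant.\<close>

lemma S_set_subset_Ces_plus:
  assumes \<theta>: "\<And>k. 0 < \<theta> k \<and> \<theta> k < 1" and F: "free_ultrafilter F"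
  shows "S_set \<theta> F \<subseteq> Ces_plus"
proof
  fix s assume "s \<in> S_set \<theta> F"
  then obtain G where G: "free_ultrafilter G" and s: "s = Blinfun (f_fun \<theta> F G)"
    by (auto simp: S_set_def)
  have s_apply: "blinfun_apply s x = f_fun \<theta> F G x" for x
    unfolding s using bounded_linear_Blinfun_apply[OF bounded_linear_f_fun[OF \<theta> F G]] by simp
  have nb: "F \<noteq> bot" "G \<noteq> bot" using F G by (auto simp: free_ultrafilter_def)
  have inner: "((\<lambda>n. Theta (\<theta> k) n x) \<longlongrightarrow> Lim G (\<lambda>n. Theta (\<theta> k) n x)) G" for k x
    using Theta_Lim(1)[OF _ _ G] \<theta> by blast
  note outer = f_fun_tendsto[OF \<theta> F G]
  have "0 \<le> f_fun \<theta> F G x" if "\<forall>i\<ge>1. 0 \<le> entry x i" for x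
  proof (rule tendsto_lowerbound[OF outer _ nb(1)], intro always_eventually allI)
    fix k show "0 \<le> Lim G (\<lambda>n. Theta (\<theta> k) n x)"
      using that \<theta> by (intro tendsto_lowerbound[OF inner _ nb(2)] always_eventually allI Theta_nonneg) auto
  qed
  moreover have "f_fun \<theta> F G x = Cesaro_mean x" if "x \<in> Ces" for x
  proof -
    have "Lim G (\<lambda>n. Theta (\<theta> k) n x) = Cesaro_mean x" for k
      using nb(2) tendsto_mono[OF free_ultrafilter_le_sequentially[OF G] Theta_tendsto_Cesaro_mean[OF _ _ that]] \<theta>
      by (intro tendsto_Lim) auto
    then show ?thesis using nb(1) by (simp add: f_fun_def tendsto_Lim[OF _ tendsto_const])
  qed
  ultimately show "s \<in> Ces_plus" by (simp add: Ces_plus_def s_apply)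
qed

section \<open>Basic properties of functionals in \<open>Ces_plus\<close>\<close>

lemma nat_bcontfunI: "(\<And>n. \<bar>g n\<bar> \<le> b) \<Longrightarrow> (g :: nat \<Rightarrow> real) \<in> bcontfun"
  by (rule bcontfun_normI) auto

lemma blinfun_nonneg:
  assumes "f \<in> Ces_plus" "\<And>p. 0 \<le> apply_bcontfun x p"
  shows "0 \<le> blinfun_apply f x"
  using assms by (auto simp: Ces_plus_def entry_def)

lemma blinfun_Cesaro_limit:
  assumes "f \<in> Ces_plus" "Cesaro_avg x \<longlonglongrightarrow> c"
  shows "blinfun_apply f x = c"
proof -
  have "x \<in> Ces" "Cesaro_mean x = c"
    using assms(2) by (auto simp: Ces_def Cesaro_mean_def convergent_def limI)
  then show ?thesis using assms(1) by (auto simp: Ces_plus_def)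
qed

lemma blinfun_const:
  assumes "f \<in> Ces_plus"
  shows "blinfun_apply f (const_bcontfun c) = c"
proof (rule blinfun_Cesaro_limit[OF assms])
  have "\<forall>\<^sub>F n in sequentially. c = Cesaro_avg (const_bcontfun c) n"
    using eventually_gt_at_top[of 0]
    by eventually_elim (simp add: Cesaro_avg_eq prefix_sum_def const_bcontfun.rep_eq)
  then show "Cesaro_avg (const_bcontfun c) \<longlonglongrightarrow> c"
    by (rule Lim_transform_eventually[OF tendsto_const])
qed

text \<open>Positivity is applied to \<open>norm x\<close> plus and minus x, constants being mapped
  to their value. This places \<open>Ces_plus\<close> in the unit ball of the dual.\<close>

lemma Ces_plus_abs_le:
  assumes f: "f \<in> Ces_plus"
  shows "\<bar>blinfun_apply f x\<bar> \<le> norm x"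
proof -
  let ?c = "const_bcontfun (norm x) :: linfty"
  have "\<bar>apply_bcontfun x p\<bar> \<le> norm x" for p
    using norm_bounded[of x p] by simp
  then have "0 \<le> norm x + apply_bcontfun x p" "0 \<le> norm x - apply_bcontfun x p" for p
    by (simp_all add: abs_le_iff) (metis abs_le_iff add.commute add_increasing2 diff_ge_0_iff_ge minus_le_iff diff_minus_eq_add)
  then have "0 \<le> blinfun_apply f (?c + x)" "0 \<le> blinfun_apply f (?c - x)"
    by (auto intro!: blinfun_nonneg[OF f]
        simp: plus_bcontfun.rep_eq minus_bcontfun.rep_eq const_bcontfun.rep_eq)
  then show ?thesis
    by (simp add: blinfun.add_right blinfun.diff_right blinfun_const[OF f] abs_le_iff)
qed

section \<open>The bound of f(x) by the supremum over S\<close>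

text \<open>
  With \<open>D\<close> the running minimum of \<open>H\<close>, the hypothesis forces \<open>H - D = o(m)\<close>: following the
  larger predecessors backwards, \<open>H m\<close> can exceed an earlier minimum only by the growth over the
  single step that jumps across it.  Hence \<open>x - q\<close> is the sum of the increments of \<open>H - D\<close>,
  which have Cesaro mean \<open>0\<close>, and the increments of \<open>D\<close>, which are nonpositive.
\<close>

lemma Ces_plus_le_if_larger_predecessors:
  fixes q :: real
  assumes f: "f \<in> Ces_plus"
    and H: "H = (\<lambda>m. prefix_sum x m - q * real m)"
    and pred: "\<And>t. 0 < t \<Longrightarrow> t < 1 \<Longrightarrow>
      \<forall>\<^sub>F m in sequentially. \<exists>m'<m. t * real m \<le> real m' + 1 \<and> H m < H m'"
  shows "blinfun_apply f x \<le> q"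
proof -
  define B where "B = norm x + \<bar>q\<bar>"
  define D where "D m = Min (H ` {..m})" for m
  define W where "W m = H m - D m" for m
  have B0: "0 \<le> B" by (simp add: B_def)
  have H_step: "\<bar>H (Suc m) - H m\<bar> \<le> B" for m
  proof -
    have "\<bar>apply_bcontfun x m\<bar> \<le> norm x" using norm_bounded[of x m] by simp
    then show ?thesis by (auto simp: H B_def algebra_simps)
  qed
  have H_growth: "H (s + k) - H s \<le> B * real k" for s k
  proof (induction k)
    case (Suc k)
    have "H (s + Suc k) - H (s + k) \<le> B" using H_step[of "s + k"] by simp
    then show ?case using Suc by (simp add: algebra_simps)
  qed simp
  have D_Suc: "D (Suc m) = min (H (Suc m)) (D m)" for m
    by (simp add: D_def atMost_Suc)
  have D_le: "D m \<le> H s" if "s \<le> m" for s m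
    using that by (simp add: D_def)
  have D_attained: "\<exists>s\<le>m. D m = H s" for m
  proof -
    have "D m \<in> H ` {..m}" unfolding D_def by (rule Min_in) auto
    then show ?thesis by auto
  qed
  have D_step: "- B \<le> D (Suc m) - D m" "D (Suc m) - D m \<le> 0" for m
    using H_step[of m] D_le[of m m] B0 by (auto simp: D_Suc min_def)
  have W0: "W 0 = 0" by (simp add: W_def D_def)
  have W_nonneg: "0 \<le> W m" for m using D_le[of m m] by (simp add: W_def)
  have W_bound: "\<exists>C. \<forall>m. W m \<le> C + B * (1 - t) * real m" if t: "0 < t" "t < 1" for t
  proof -
    obtain N where N: "\<And>m. m \<ge> N \<Longrightarrow> \<exists>m'<m. t * real m \<le> real m' + 1 \<and> H m < H m'"
      using pred[OF t] by (auto simp: eventually_sequentially)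
    \<comment> \<open>Absorbs the finitely many m below \<open>N\<close>, for which no larger
      predecessor is available.\<close>
    define C where "C = Max (insert 0 (W ` {..<N}))"
    have C: "0 \<le> C" "m < N \<Longrightarrow> W m \<le> C" for m by (auto simp: C_def)
    have "W m \<le> C + B * (1 - t) * real m" for m
    proof (induction m rule: less_induct)
      case (less m)
      have lin: "0 \<le> B * (1 - t) * real k" for k using B0 t by simp
      show ?case
      proof (cases "m < N")
        case True
        then show ?thesis using C(2)[OF True] lin[of m] by linarith
      next
        case False
        then obtain m' where m': "m' < m" "t * real m \<le> real m' + 1" "H m < H m'"
          using N[of m] by auto
        obtain s where s: "s \<le> m" "D m = H s" using D_attained by blast
        show ?thesis
        proof (cases "s \<le> m'")
          case True
          \<comment> \<open>The minimum up to m is already attained by m', so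
            \<open>D m' \<le> H s = D m\<close>, while \<open>H m < H m'\<close>.\<close>
          then have "W m \<le> W m'" using m' s D_le[of s m'] by (simp add: W_def)
          also have "\<dots> \<le> C + B * (1 - t) * real m'" using less m'(1) .
          also have "\<dots> \<le> C + B * (1 - t) * real m"
            using m'(1) B0 t by (intro add_left_mono mult_left_mono) auto
          finally show ?thesis .
        next
          case False
          \<comment> \<open>Now \<open>m' + 1 \<le> s\<close>, so the slack 1 in the hypothesis is
            absorbed: \<open>t * m \<le> s\<close>.\<close>
          have "real (m - s) \<le> (1 - t) * real m"
            using False m'(2) s(1) by (simp add: of_nat_diff algebra_simps)
          then have "B * real (m - s) \<le> B * ((1 - t) * real m)" using B0 by (intro mult_left_mono)
          moreover have "W m \<le> B * real (m - s)"
            using H_growth[of s "m - s"] s by (simp add: W_def)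
          ultimately show ?thesis using C(1) by (simp add: mult.assoc)
        qed
      qed
    qed
    then show ?thesis by blast
  qed
  \<comment> \<open>The increments of \<open>D\<close> and \<open>W\<close> are bounded, so
    \<open>Bcontfun\<close> is meaningful; the prefix sums of \<open>u\<close> telescope to
    \<open>W\<close>.\<close>
  define d where "d = Bcontfun (\<lambda>p. D (Suc p) - D p)"
  define u where "u = Bcontfun (\<lambda>p. W (Suc p) - W p)"
  have "\<bar>D (Suc p) - D p\<bar> \<le> B" for p
    using D_step[of p] by linarith
  then have d_apply: "apply_bcontfun d p = D (Suc p) - D p" for p
    unfolding d_def by (subst Bcontfun_inverse[OF nat_bcontfunI[of _ B]]) auto
  have "\<bar>W (Suc p) - W p\<bar> \<le> B + B" for p
    using H_step[of p] D_step[of p] by (simp add: W_def)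
  then have u_apply: "apply_bcontfun u p = W (Suc p) - W p" for p
    unfolding u_def by (subst Bcontfun_inverse[OF nat_bcontfunI[of _ "B + B"]]) auto
  have "prefix_sum u m = W m" for m
    by (induction m) (simp_all add: u_apply W0)
  then have u_avg: "Cesaro_avg u m = W m / real m" for m by (simp add: Cesaro_avg_eq)
  have "Cesaro_avg u \<longlonglongrightarrow> 0"
  proof (rule order_tendstoI)
    fix e :: real assume e: "e > 0"
    \<comment> \<open>Chosen to make \<open>B * (1 - t)\<close> at most e/2. The cap 1/2 keeps t
      positive, and \<open>B + 1\<close> avoids a zero denominator.\<close>
    define t where "t = 1 - min (1/2) (e / (2 * (B + 1)))"
    have t: "0 < t" "t < 1" using e B0 by (auto simp: t_def min_def)
    have Bt: "B * (1 - t) \<le> e / 2"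
    proof -
      have "B * (1 - t) \<le> (B + 1) * (e / (2 * (B + 1)))"
        using B0 e by (intro mult_mono) (auto simp: t_def)
      also have "\<dots> = e / 2" using B0 by (simp add: field_simps)
      finally show ?thesis .
    qed
    obtain C where C: "\<And>m. W m \<le> C + B * (1 - t) * real m" using W_bound[OF t] by blast
    have "(\<lambda>m. C / real m + e / 2) \<longlonglongrightarrow> 0 + e / 2"
      by (intro tendsto_intros lim_const_over_n)
    then have "\<forall>\<^sub>F m in sequentially. C / real m + e / 2 < e"
      by (rule order_tendstoD(2)) (use e in simp)
    then show "\<forall>\<^sub>F m in sequentially. Cesaro_avg u m < e"
      using eventually_gt_at_top[of 0]
    proof eventually_elim
      case (elim m)
      have "W m \<le> C + (e / 2) * real m"
        using C[of m] mult_right_mono[OF Bt, of "real m"] by simp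
      then have "W m / real m \<le> (C + (e / 2) * real m) / real m" by (intro divide_right_mono) auto
      also have "\<dots> = C / real m + e / 2" using elim by (simp add: add_divide_distrib)
      finally show ?case using elim by (simp add: u_avg)
    qed
  next
    fix a :: real assume "a < 0"
    then show "\<forall>\<^sub>F m in sequentially. a < Cesaro_avg u m"
      by (intro always_eventually allI) (smt (verit) u_avg W_nonneg divide_nonneg_nonneg of_nat_0_le_iff)
  qed
  then have fu: "blinfun_apply f u = 0" by (rule blinfun_Cesaro_limit[OF f])
  have "0 \<le> blinfun_apply f (- d)"
    using D_step by (intro blinfun_nonneg[OF f]) (simp add: uminus_bcontfun.rep_eq d_apply)
  then have fd: "blinfun_apply f d \<le> 0" by (simp add: blinfun.minus_right)
  have "x = u + d + const_bcontfun q"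
    by (rule bcontfun_eqI)
      (simp add: plus_bcontfun.rep_eq const_bcontfun.rep_eq u_apply d_apply W_def H algebra_simps)
  then have "blinfun_apply f x = blinfun_apply f u + blinfun_apply f d + q"
    by (metis blinfun.add_right blinfun_const[OF f])
  then show ?thesis using fu fd by simp
qed

lemma Ces_plus_le_if_f_fun_le:
  assumes \<theta>: "\<And>k. 0 < \<theta> k \<and> \<theta> k < 1" and lim: "filterlim \<theta> (at_left 1) sequentially"
    and F: "free_ultrafilter F" and f: "f \<in> Ces_plus"
    and le: "\<And>G. free_ultrafilter G \<Longrightarrow> f_fun \<theta> F G x \<le> r"
  shows "blinfun_apply f x \<le> r"
proof (rule field_le_epsilon)
  fix e :: real assume e: "0 < e"
  define q where "q = r + e"
  define H where "H = (\<lambda>m. prefix_sum x m - q * real m)"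
  have "\<forall>\<^sub>F m in sequentially. \<exists>m'<m. t * real m \<le> real m' + 1 \<and> H m < H m'"
    if t: "0 < t" "t < 1" for t
  proof (rule ccontr)
    \<comment> \<open>The indices at which \<open>H\<close> is maximal over the window from t m - 1
      to m. The extra 1 lets the window contain the floor of \<theta>m for every \<theta> \<ge>
      t.\<close>
    define A where "A = {m. \<forall>m'<m. t * real m \<le> real m' + 1 \<longrightarrow> H m' \<le> H m}"
    assume "\<not> ?thesis"
    then have "\<exists>\<^sub>F m in sequentially. m \<in> A"
      by (auto simp: A_def not_eventually not_less elim!: frequently_elim1)
    then have "infinite A"
      by (simp add: frequently_cofinite flip: cofinite_eq_sequentially)
    then obtain G where G: "free_ultrafilter G" and GA: "\<forall>\<^sub>F m in G. m \<in> A"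
      by (rule ex_free_ultrafilter_containing)
    have G_le: "G \<le> sequentially" by (rule free_ultrafilter_le_sequentially[OF G])
    have nb: "F \<noteq> bot" "G \<noteq> bot" using F G by (auto simp: free_ultrafilter_def)
    have G_ge: "q \<le> Lim G (\<lambda>n. Theta (\<theta> k) n x)" if k: "t \<le> \<theta> k" for k
    proof (rule tendsto_le[OF nb(2) Theta_Lim(1)[OF _ _ G]])
      \<comment> \<open>Replacing the length m - m' by m (1 - \<theta>) changes it by at most 1,
        hence the numerator by at most |q|; after division this error vanishes along
        \<open>G\<close>.\<close>
      let ?c = "\<bar>q\<bar> / (1 - \<theta> k)"
      have "(\<lambda>m. q - ?c / real m) \<longlonglongrightarrow> q - 0"
        by (intro tendsto_intros lim_const_over_n)
      then show "((\<lambda>m. q - ?c / real m) \<longlongrightarrow> q) G"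
        using tendsto_mono[OF G_le] by simp
      have "\<forall>\<^sub>F m in G. 0 < m" using eventually_gt_at_top G_le by (rule filter_leD[rotated])
      with GA show "\<forall>\<^sub>F m in G. q - ?c / real m \<le> Theta (\<theta> k) m x"
      proof eventually_elim
        case (elim m)
        let ?m' = "nat \<lfloor>\<theta> k * real m\<rfloor>"
        have m': "real ?m' \<le> \<theta> k * real m" "\<theta> k * real m \<le> real ?m' + 1"
          using \<theta>[of k] by (simp, linarith)
        have "\<theta> k * real m < real m" using \<theta>[of k] elim by simp
        then have "?m' < m" using m'(1) by linarith
        moreover have "t * real m \<le> real ?m' + 1"
          using mult_right_mono[OF k, of "real m"] m'(2) by simp
        ultimately have "H ?m' \<le> H m" using elim(1) by (simp add: A_def)
        then have "q * (real m - real ?m') \<le> prefix_sum x m - prefix_sum x ?m'"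
          by (simp add: H_def algebra_simps)
        moreover have "q * (real m * (1 - \<theta> k)) - \<bar>q\<bar> \<le> q * (real m - real ?m')"
        proof -
          have "\<bar>\<theta> k * real m - real ?m'\<bar> \<le> 1" using m' by linarith
          then have "\<bar>q * (\<theta> k * real m - real ?m')\<bar> \<le> \<bar>q\<bar>"
            by (simp add: abs_mult mult_left_le)
          then have "- \<bar>q\<bar> \<le> q * (\<theta> k * real m - real ?m')" by linarith
          then show ?thesis by (simp add: algebra_simps)
        qed
        ultimately have "(q * (real m * (1 - \<theta> k)) - \<bar>q\<bar>) / (real m * (1 - \<theta> k)) \<le> Theta (\<theta> k) m x"
          using \<theta>[of k] by (simp add: Theta_eq_prefix_sum divide_right_mono)
        moreover have "(q * (real m * (1 - \<theta> k)) - \<bar>q\<bar>) / (real m * (1 - \<theta> k)) = q - ?c / real m"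
          using \<theta>[of k] elim by (simp add: diff_divide_distrib)
        ultimately show ?case by simp
      qed
    qed (use \<theta> in auto)
    \<comment> \<open>Here the convergence of \<theta> to 1 enters: \<open>G_ge\<close> applies to
      F-almost all k with the same \<open>G\<close>.\<close>
    have "\<forall>\<^sub>F k in sequentially. t < \<theta> k"
      using lim order_tendstoD(1)[of \<theta> 1 sequentially t] t by (simp add: filterlim_at)
    then have "\<forall>\<^sub>F k in F. t < \<theta> k"
      by (rule filter_leD[OF free_ultrafilter_le_sequentially[OF F]])
    then have "\<forall>\<^sub>F k in F. q \<le> Lim G (\<lambda>n. Theta (\<theta> k) n x)"
      by eventually_elim (rule G_ge, simp)
    then have "q \<le> f_fun \<theta> F G x"
      by (rule tendsto_lowerbound[OF f_fun_tendsto[OF \<theta> F G] _ nb(1)])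
    then show False using le[OF G] e by (simp add: q_def)
  qed
  then have "blinfun_apply f x \<le> q"
    by (rule Ces_plus_le_if_larger_predecessors[OF f H_def])
  then show "blinfun_apply f x \<le> r + e" by (simp add: q_def)
qed

section \<open>Closedness, convexity and compactness in the weak-star topology\<close>

text \<open>A basic open set of the product topology restricts only finitely many coordinates, and
  the least of the corresponding radii serves as a common e.\<close>

lemma in_weak_star_closureI:
  fixes f :: linfty_dual
  assumes "\<And>X e. finite X \<Longrightarrow> 0 < e \<Longrightarrow>
    \<exists>g\<in>A. \<forall>x\<in>X. \<bar>blinfun_apply g x - blinfun_apply f x\<bar> < e"
  shows "f \<in> weak_star closure_of A"
  unfolding in_closure_of strong_operator_topology_topspace
proof (intro conjI UNIV_I allI impI)
  fix T :: "linfty_dual set" assume T: "f \<in> T \<and> openin weak_star T"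
  then obtain V where V: "open V" and T_eq: "T = blinfun_apply -` V"
    by (auto simp: strong_operator_topology_def openin_pullback_topology)
  have "openin (product_topology (\<lambda>_. euclidean) UNIV) V" "blinfun_apply f \<in> V"
    using V T T_eq by (auto simp: open_fun_def)
  from product_topology_open_contains_basis[OF this] obtain U
    where U: "blinfun_apply f \<in> Pi\<^sub>E UNIV U" "\<And>x. open (U x)" "finite {x. U x \<noteq> UNIV}"
      "Pi\<^sub>E UNIV U \<subseteq> V"
    by auto
  let ?X = "{x. U x \<noteq> UNIV}"
  have "\<exists>e>0. ball (blinfun_apply f x) e \<subseteq> U x" for x
    using U(1,2) by (auto simp: open_contains_ball)
  then obtain e where e: "\<And>x. 0 < e x" "\<And>x. ball (blinfun_apply f x) (e x) \<subseteq> U x" by metis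
  define d where "d = Min (insert 1 (e ` ?X))"
  have d: "0 < d" "x \<in> ?X \<Longrightarrow> d \<le> e x" for x
    using U(3) e(1) by (auto simp: d_def)
  obtain g where g: "g \<in> A" "\<And>x. x \<in> ?X \<Longrightarrow> \<bar>blinfun_apply g x - blinfun_apply f x\<bar> < d"
    using assms[OF U(3) d(1)] by blast
  have "blinfun_apply g x \<in> U x" for x
  proof (cases "x \<in> ?X")
    case True
    then have "blinfun_apply g x \<in> ball (blinfun_apply f x) (e x)"
      using g(2)[OF True] d(2)[OF True] by (simp add: dist_real_def)
    then show ?thesis using e(2) by blast
  qed auto
  then have "g \<in> T" using U(4) by (auto simp: T_eq PiE_def)
  then show "\<exists>y. y \<in> A \<and> y \<in> T" using g(1) by blast
qed

lemma closedin_weak_star_half_space: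
  "closedin weak_star {f :: linfty_dual. c \<le> blinfun_apply f x}"
proof -
  have "closedin weak_star {f \<in> topspace weak_star. blinfun_apply f x \<in> {c..}}"
    by (rule closedin_continuous_map_preimage[OF strong_operator_topology_continuous_evaluation]) simp
  then show ?thesis by (simp add: strong_operator_topology_topspace)
qed

text \<open>Splitting the equality on \<open>Ces\<close> into two inequalities leaves only half
  spaces, from which closedness and convexity are both read off.\<close>

lemma Ces_plus_eq_Inter_half_spaces:
  "Ces_plus = (\<Inter>x\<in>{x. \<forall>i\<ge>1. 0 \<le> entry x i}. {f. 0 \<le> blinfun_apply f x})
    \<inter> (\<Inter>x\<in>Ces. {f. Cesaro_mean x \<le> blinfun_apply f x})
    \<inter> (\<Inter>x\<in>Ces. {f. - Cesaro_mean x \<le> blinfun_apply f (- x)})"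
  by (auto simp: Ces_plus_def blinfun.minus_right intro: antisym)

lemma closedin_Ces_plus: "closedin weak_star Ces_plus"
proof -
  have *: "closedin weak_star (\<Inter>x\<in>A. {f :: linfty_dual. c x \<le> blinfun_apply f (g x)})" for A c and g :: "linfty \<Rightarrow> linfty"
    using closedin_weak_star_half_space
    by (cases "A = {}") (auto intro!: closedin_Inter simp: closedin_topspace[of weak_star, unfolded strong_operator_topology_topspace])
  show ?thesis
    unfolding Ces_plus_eq_Inter_half_spaces by (intro closedin_Int *)
qed

lemma convex_half_space: "convex {f :: linfty_dual. c \<le> blinfun_apply f x}"
proof -
  have "linear (\<lambda>f :: linfty_dual. blinfun_apply f x)"
    by (rule linearI) (simp_all add: blinfun.add_left blinfun.scaleR_left)
  from convex_linear_vimage[OF this, of "{c..}"] show ?thesis by (simp add: vimage_def)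
qed

lemma convex_Ces_plus: "convex Ces_plus"
  unfolding Ces_plus_eq_Inter_half_spaces by (intro convex_Int convex_INT convex_half_space)

text \<open>Distinct functionals differ at some vector. The property is what makes compact hulls
  closed in Milman's argument.\<close>

lemma Hausdorff_weak_star: "Hausdorff_space (weak_star :: linfty_dual topology)"
  unfolding Hausdorff_space_def strong_operator_topology_topspace
proof (intro allI impI, elim conjE)
  fix f g :: linfty_dual assume "f \<noteq> g"
  then obtain x where "blinfun_apply f x \<noteq> blinfun_apply g x"
    using blinfun_eqI by blast
  from hausdorff[OF this] obtain U V where UV: "open U" "open V"
    "blinfun_apply f x \<in> U" "blinfun_apply g x \<in> V" "U \<inter> V = {}"
    by (elim exE conjE)
  have "openin weak_star {h :: linfty_dual. blinfun_apply h x \<in> W}" if "open W" for W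
    using strong_operator_topology_basis[of "{()}" "\<lambda>_. W" "\<lambda>_. x"] that by simp
  then show "\<exists>U V. openin weak_star U \<and> openin weak_star V \<and> f \<in> U \<and> g \<in> V \<and> disjnt U V"
    using UV by (intro exI[of _ "{h. blinfun_apply h x \<in> U}"] exI[of _ "{h. blinfun_apply h x \<in> V}"])
      (auto simp: disjnt_def)
qed

text \<open>The Banach-Alaoglu theorem: by Tychonoff the product of the intervals is compact,
  linearity is a closed condition on coordinates, and \<open>Blinfun\<close> carries the resulting
  compact set continuously onto the ball.\<close>

lemma compactin_weak_star_unit_ball:
  "compactin weak_star {f :: linfty_dual. \<forall>x. \<bar>blinfun_apply f x\<bar> \<le> norm x}"
proof -
  define T where "T = {\<phi> :: linfty \<Rightarrow> real. (\<forall>x. \<bar>\<phi> x\<bar> \<le> norm x) \<and>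
    (\<forall>x y. \<phi> (x + y) = \<phi> x + \<phi> y) \<and> (\<forall>r x. \<phi> (r *\<^sub>R x) = r * \<phi> x)}"
  have "compactin (product_topology (\<lambda>_. euclidean) UNIV) (Pi\<^sub>E UNIV (\<lambda>x :: linfty. {- norm x..norm x}))"
    by (simp add: compactin_PiE)
  then have "compact (Pi\<^sub>E UNIV (\<lambda>x :: linfty. {- norm x..norm x}))"
    by (simp add: euclidean_product_topology)
  moreover have "closed {\<phi> :: linfty \<Rightarrow> real. (\<forall>x y. \<phi> (x + y) = \<phi> x + \<phi> y) \<and> (\<forall>r x. \<phi> (r *\<^sub>R x) = r * \<phi> x)}"
    by (intro closed_Collect_conj closed_Collect_all closed_Collect_eq continuous_intros
        continuous_on_product_coordinates)
  moreover have "T = Pi\<^sub>E UNIV (\<lambda>x. {- norm x..norm x}) \<inter>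
      {\<phi>. (\<forall>x y. \<phi> (x + y) = \<phi> x + \<phi> y) \<and> (\<forall>r x. \<phi> (r *\<^sub>R x) = r * \<phi> x)}"
    by (auto simp: T_def PiE_iff abs_le_iff minus_le_iff)
  ultimately have "compactin (top_of_set T) T"
    by (simp add: compact_Int_closed)
  moreover have Blinfun_T: "blinfun_apply (Blinfun \<phi>) = \<phi>" if "\<phi> \<in> T" for \<phi>
  proof (rule bounded_linear_Blinfun_apply)
    show "bounded_linear \<phi>"
      by (rule bounded_linear_intro[of _ 1]) (use that in \<open>auto simp: T_def\<close>)
  qed
  have "continuous_map (top_of_set T) weak_star Blinfun"
    unfolding continuous_on_strong_operator_topo_iff_coordinatewise
  proof
    fix x
    have "continuous_on T (\<lambda>\<phi>. \<phi> x)"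
      by (rule continuous_on_subset[OF continuous_on_product_coordinates]) simp
    then have "continuous_on T (\<lambda>\<phi>. blinfun_apply (Blinfun \<phi>) x)"
      by (rule continuous_on_eq) (simp add: Blinfun_T)
    then show "continuous_map (top_of_set T) euclidean (\<lambda>\<phi>. blinfun_apply (Blinfun \<phi>) x)"
      by simp
  qed
  ultimately have "compactin weak_star (Blinfun ` T)" by (metis image_compactin)
  moreover have "Blinfun ` T = {f. \<forall>x. \<bar>blinfun_apply f x\<bar> \<le> norm x}"
  proof (intro set_eqI iffI)
    fix f :: linfty_dual assume "f \<in> {f. \<forall>x. \<bar>blinfun_apply f x\<bar> \<le> norm x}"
    then have "blinfun_apply f \<in> T"
      by (simp add: T_def blinfun.add_right blinfun.scaleR_right)
    then show "f \<in> Blinfun ` T" by (metis blinfun_apply_inverse image_eqI)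
  qed (auto simp: Blinfun_T, auto simp: T_def)
  ultimately show ?thesis by simp
qed

section \<open>Convex hulls of finite unions of compact convex sets\<close>

lemma compactin_weak_star_join:
  fixes A B :: "linfty_dual set"
  assumes "compactin weak_star A" "compactin weak_star B"
  shows "compactin weak_star ((\<lambda>(t, a, b). (1 - t) *\<^sub>R a + t *\<^sub>R b) ` ({0..1} \<times> A \<times> B))"
proof (rule image_compactin)
  show "compactin (prod_topology euclideanreal (prod_topology weak_star weak_star)) ({0..1} \<times> A \<times> B)"
    using assms by (simp add: compactin_Times)
  let ?P = "prod_topology euclideanreal (prod_topology weak_star (weak_star :: linfty_dual topology))"
  note ev =
    continuous_map_compose[OF continuous_map_compose[OF continuous_map_snd continuous_map_fst]
      strong_operator_topology_continuous_evaluation, unfolded comp_def]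
    continuous_map_compose[OF continuous_map_compose[OF continuous_map_snd continuous_map_snd]
      strong_operator_topology_continuous_evaluation, unfolded comp_def]
  have "continuous_map ?P euclideanreal
      (\<lambda>z. (1 - fst z) * blinfun_apply (fst (snd z)) x + fst z * blinfun_apply (snd (snd z)) x)" for x
    by (intro continuous_map_add continuous_map_real_mult continuous_map_diff
        continuous_map_canonical_const continuous_map_fst ev)
  then show "continuous_map ?P weak_star (\<lambda>(t, a, b). (1 - t) *\<^sub>R a + t *\<^sub>R b)"
    unfolding continuous_on_strong_operator_topo_iff_coordinatewise
    by (simp add: case_prod_beta blinfun.add_left blinfun.scaleR_left)
qed

text \<open>The unnormalised form also covers \<open>u + v = 0\<close>, sparing
  \<open>convex_join\<close> a case distinction.\<close>

lemma convex_scaled_combination: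
  assumes "convex A" "a \<in> A" "b \<in> A" "0 \<le> (u::real)" "0 \<le> v"
  obtains c where "c \<in> A" "u *\<^sub>R a + v *\<^sub>R b = (u + v) *\<^sub>R c"
proof (cases "u + v = 0")
  case True
  then have "u = 0" "v = 0" using assms by auto
  then show ?thesis using that[of a] assms by simp
next
  case False
  let ?c = "(u / (u + v)) *\<^sub>R a + (v / (u + v)) *\<^sub>R b"
  have "u / (u + v) + v / (u + v) = 1" using False by (simp flip: add_divide_distrib)
  then have "?c \<in> A" using assms by (intro convexD) auto
  moreover have "u *\<^sub>R a + v *\<^sub>R b = (u + v) *\<^sub>R ?c"
    using False by (simp add: scaleR_add_right)
  ultimately show ?thesis by (rule that)
qed

text \<open>Mixing two points with weights u and v regroups into a part from \<open>A\<close> and a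
  part from \<open>B\<close>; convexity contracts each part to one point, and the two total weights
  add up to 1.\<close>

lemma convex_join:
  fixes A B :: "'a::real_vector set"
  assumes "convex A" "convex B"
  shows "convex ((\<lambda>(t, a, b). (1 - t) *\<^sub>R a + t *\<^sub>R b) ` ({0..1} \<times> A \<times> B))" (is "convex ?J")
proof (rule convexI)
  fix x y and u v :: real
  assume "x \<in> ?J" "y \<in> ?J" and uv: "0 \<le> u" "0 \<le> v" "u + v = 1"
  then obtain s a b t a' b' where
    x: "x = (1 - s) *\<^sub>R a + s *\<^sub>R b" "0 \<le> s" "s \<le> 1" "a \<in> A" "b \<in> B" and
    y: "y = (1 - t) *\<^sub>R a' + t *\<^sub>R b'" "0 \<le> t" "t \<le> 1" "a' \<in> A" "b' \<in> B"
    by auto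
  obtain c where c: "c \<in> A"
    "(u * (1 - s)) *\<^sub>R a + (v * (1 - t)) *\<^sub>R a' = (u * (1 - s) + v * (1 - t)) *\<^sub>R c"
    by (rule convex_scaled_combination[OF assms(1) x(4) y(4), of "u * (1 - s)" "v * (1 - t)"])
      (use uv x y in auto)
  obtain d where d: "d \<in> B"
    "(u * s) *\<^sub>R b + (v * t) *\<^sub>R b' = (u * s + v * t) *\<^sub>R d"
    by (rule convex_scaled_combination[OF assms(2) x(5) y(5), of "u * s" "v * t"])
      (use uv x y in auto)
  have weight: "u * (1 - s) + v * (1 - t) = 1 - (u * s + v * t)"
    using uv(3) by (simp add: algebra_simps)
  have "u *\<^sub>R x + v *\<^sub>R y
      = ((u * (1 - s)) *\<^sub>R a + (v * (1 - t)) *\<^sub>R a') + ((u * s) *\<^sub>R b + (v * t) *\<^sub>R b')"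
    by (simp add: x(1) y(1) scaleR_add_right)
  also have "\<dots> = (1 - (u * s + v * t)) *\<^sub>R c + (u * s + v * t) *\<^sub>R d"
    by (simp only: c(2) d(2) weight)
  finally have "u *\<^sub>R x + v *\<^sub>R y = (1 - (u * s + v * t)) *\<^sub>R c + (u * s + v * t) *\<^sub>R d" .
  moreover have "0 \<le> u * s + v * t" using uv x y by simp
  moreover have "u * s + v * t \<le> 1" using uv x y by (intro convex_bound_le) auto
  ultimately show "u *\<^sub>R x + v *\<^sub>R y \<in> ?J"
    using c(1) d(1) by (intro image_eqI[of _ _ "(u * s + v * t, c, d)"]) auto
qed

lemma convex_hull_Un_eq_join:
  fixes A B :: "'a::real_vector set"
  assumes "convex A" "convex B" "A \<noteq> {}" "B \<noteq> {}"
  shows "convex hull (A \<union> B) = (\<lambda>(t, a, b). (1 - t) *\<^sub>R a + t *\<^sub>R b) ` ({0..1} \<times> A \<times> B)"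
    (is "_ = ?J")
proof
  obtain a0 b0 where "a0 \<in> A" "b0 \<in> B" using assms by blast
  then have "a \<in> ?J" if "a \<in> A" for a
    using that by (intro image_eqI[of _ _ "(0, a, b0)"]) auto
  moreover have "b \<in> ?J" if "b \<in> B" for b
    using that \<open>a0 \<in> A\<close> by (intro image_eqI[of _ _ "(1, a0, b)"]) auto
  ultimately show "convex hull (A \<union> B) \<subseteq> ?J"
    by (intro hull_minimal convex_join assms) blast
  show "?J \<subseteq> convex hull (A \<union> B)"
  proof clarify
    fix t :: real and a b assume "t \<in> {0..1}" "a \<in> A" "b \<in> B"
    then show "(1 - t) *\<^sub>R a + t *\<^sub>R b \<in> convex hull (A \<union> B)"
      by (intro convexD[OF convex_convex_hull]) (auto intro: hull_inc)
  qed
qed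

text \<open>Induction on \<open>I\<close>, joining one set at a time to the hull of the others.
  Empty sets are treated apart because a join with an empty set is empty.\<close>

lemma compactin_convex_hull_UN:
  fixes K :: "'i \<Rightarrow> linfty_dual set"
  assumes "finite I" "\<And>i. i \<in> I \<Longrightarrow> compactin weak_star (K i)" "\<And>i. i \<in> I \<Longrightarrow> convex (K i)"
  shows "compactin weak_star (convex hull (\<Union>i\<in>I. K i))"
  using assms
proof (induction I)
  case (insert i I)
  let ?H = "convex hull (\<Union>i\<in>I. K i)"
  have H: "compactin weak_star ?H" using insert by simp
  have K: "compactin weak_star (K i)" "convex (K i)" using insert by simp_all
  have "convex hull (\<Union>i\<in>insert i I. K i) = convex hull (K i \<union> ?H)"
    unfolding UN_insert by (rule hull_Un_right)
  moreover have "compactin weak_star (convex hull (K i \<union> ?H))"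
  proof (cases "K i = {} \<or> ?H = {}")
    case True
    then have "K i \<union> ?H = K i \<or> K i \<union> ?H = ?H" by blast
    then show ?thesis using H K by (auto simp: hull_same hull_hull)
  next
    case False
    then show ?thesis
      using compactin_weak_star_join[OF K(1) H] K(2)
      by (simp only: convex_hull_Un_eq_join convex_convex_hull de_Morgan_disj simp_thms)
  qed
  ultimately show ?case by simp
qed simp

section \<open>Separation, and density of the convex hull of S\<close>

text \<open>
  An almost minimiser \<open>g\<close> of the squared distance \<open>N\<close> in the coordinates \<open>X\<close> yields the separating
  vector, as for the projection onto a closed convex set.
\<close>

lemma weak_star_separation:
  fixes f :: linfty_dual
  assumes C: "convex C" "C \<noteq> {}" and X: "finite X" and e: "0 < e"
    and bound: "\<And>g x. g \<in> C \<Longrightarrow> \<bar>blinfun_apply g x\<bar> \<le> norm x"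
    and far: "\<And>g. g \<in> C \<Longrightarrow> \<exists>x\<in>X. e \<le> \<bar>blinfun_apply g x - blinfun_apply f x\<bar>"
  obtains y c where "\<And>g. g \<in> C \<Longrightarrow> blinfun_apply g y \<le> c" "c < blinfun_apply f y"
proof -
  define N where "N g = (\<Sum>x\<in>X. (blinfun_apply f x - blinfun_apply g x)\<^sup>2)" for g
  define D where "D = Inf (N ` C)"
  \<comment> \<open>Bounds the squared distance between two members of \<open>C\<close> in the
    coordinates \<open>X\<close>; the added 1 makes it positive. The choice of t below then keeps
    the quadratic term \<open>t\<^sup>2 * M\<close> under t D / 2.\<close>
  define M where "M = (\<Sum>x\<in>X. (2 * norm x)\<^sup>2) + 1"
  have N_ge: "e\<^sup>2 \<le> N g" if "g \<in> C" for g
  proof -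
    obtain x where x: "x \<in> X" "e \<le> \<bar>blinfun_apply g x - blinfun_apply f x\<bar>" using far[OF \<open>g \<in> C\<close>] by blast
    then have "e \<le> \<bar>blinfun_apply f x - blinfun_apply g x\<bar>" by linarith
    then have "e\<^sup>2 \<le> \<bar>blinfun_apply f x - blinfun_apply g x\<bar>\<^sup>2" using e by (intro power_mono) auto
    also have "\<dots> = (blinfun_apply f x - blinfun_apply g x)\<^sup>2" by simp
    also have "\<dots> \<le> N g" unfolding N_def using X x(1) by (intro member_le_sum) auto
    finally show ?thesis .
  qed
  have "e\<^sup>2 \<le> D" unfolding D_def using C(2) N_ge by (intro cInf_greatest) auto
  then have D0: "0 < D" using e by (smt (verit) zero_less_power)
  have D_le: "D \<le> N g" if "g \<in> C" for g
    unfolding D_def using that N_ge by (intro cInf_lower bdd_belowI[of _ "e\<^sup>2"]) auto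
  have M0: "0 < M" unfolding M_def by (intro add_nonneg_pos sum_nonneg) auto
  define t where "t = min 1 (D / (2 * M))"
  have t: "0 < t" "t \<le> 1" using D0 M0 by (auto simp: t_def)
  have tM: "t * M \<le> D / 2"
  proof -
    have "t * M \<le> D / (2 * M) * M" using M0 by (intro mult_right_mono) (auto simp: t_def)
    then show ?thesis using M0 by simp
  qed
  \<comment> \<open>The tolerance t D / 2 and the quadratic term add up to t D, which division by 2
    t turns into D / 2. This is less than \<open>N g\<close>, the gap between \<open>f\<close> and
    \<open>g\<close> at \<open>y\<close>.\<close>
  have "Inf (N ` C) < D + t * D / 2" using D0 t by (simp add: D_def)
  then obtain g where g: "g \<in> C" "N g < D + t * D / 2"
    using cInf_lessD[of "N ` C"] C(2) by blast
  define y where "y = (\<Sum>x\<in>X. (blinfun_apply f x - blinfun_apply g x) *\<^sub>R x)"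
  have apply_y: "blinfun_apply h y = (\<Sum>x\<in>X. (blinfun_apply f x - blinfun_apply g x) * blinfun_apply h x)" for h
    by (simp add: y_def blinfun.sum_right blinfun.scaleR_right)
  have "blinfun_apply h y \<le> blinfun_apply g y + D / 2" if h: "h \<in> C" for h
  proof -
    let ?p = "(1 - t) *\<^sub>R g + t *\<^sub>R h"
    let ?\<delta> = "\<lambda>x. blinfun_apply h x - blinfun_apply g x"
    have p_apply: "blinfun_apply ?p x = (1 - t) * blinfun_apply g x + t * blinfun_apply h x" for x
      by (simp add: blinfun.add_left blinfun.scaleR_left)
    have "?p \<in> C" using C(1) g(1) h t by (intro convexD) auto
    then have "D \<le> N ?p" by (rule D_le)
    also have "N ?p = (\<Sum>x\<in>X. (blinfun_apply f x - blinfun_apply g x)\<^sup>2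
        - 2 * t * ((blinfun_apply f x - blinfun_apply g x) * ?\<delta> x) + t\<^sup>2 * (?\<delta> x)\<^sup>2)"
      unfolding N_def p_apply
      by (intro sum.cong refl) (simp add: power2_eq_square algebra_simps)
    also have "\<dots> = N g - 2 * t * (blinfun_apply h y - blinfun_apply g y) + t\<^sup>2 * (\<Sum>x\<in>X. (?\<delta> x)\<^sup>2)"
      by (simp add: N_def apply_y sum.distrib sum_subtractf right_diff_distrib
          flip: sum_distrib_left)
    also have "(\<Sum>x\<in>X. (?\<delta> x)\<^sup>2) \<le> M"
    proof -
      have "(?\<delta> x)\<^sup>2 \<le> (2 * norm x)\<^sup>2" for x
      proof (rule abs_le_square_iff[THEN iffD1])
        show "\<bar>?\<delta> x\<bar> \<le> \<bar>2 * norm x\<bar>" using bound[OF h, of x] bound[OF g(1), of x] by simp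
      qed
      then have "(\<Sum>x\<in>X. (?\<delta> x)\<^sup>2) \<le> (\<Sum>x\<in>X. (2 * norm x)\<^sup>2)" by (rule sum_mono)
      then show ?thesis by (simp add: M_def)
    qed
    finally have "D \<le> N g - 2 * t * (blinfun_apply h y - blinfun_apply g y) + t\<^sup>2 * M"
      by (simp add: mult_left_mono)
    moreover have "t\<^sup>2 * M \<le> t * (D / 2)"
      using mult_left_mono[OF tM, of t] t by (simp add: power2_eq_square mult.assoc)
    ultimately have "2 * t * (blinfun_apply h y - blinfun_apply g y) \<le> 2 * t * (D / 2)"
      using g(2) by simp
    then show ?thesis using t by simp
  qed
  moreover have "blinfun_apply f y - blinfun_apply g y = N g"
    by (simp add: apply_y N_def power2_eq_square algebra_simps flip: sum_subtractf)
  then have "blinfun_apply g y + D / 2 < blinfun_apply f y"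
    using D_le[OF g(1)] D0 by simp
  ultimately show thesis by (rule that)
qed

lemma compactin_Ces_plus: "compactin weak_star Ces_plus"
  by (rule closed_compactin[OF compactin_weak_star_unit_ball _ closedin_Ces_plus])
    (use Ces_plus_abs_le in blast)

text \<open>If f were outside the closure, a separating y would satisfy f_G(y) \<le> c < f(y) for
  all free G, against \<open>Ces_plus_le_if_f_fun_le\<close>.\<close>

lemma Ces_plus_subset_closure_convex_hull:
  assumes \<theta>: "\<And>k. 0 < \<theta> k \<and> \<theta> k < 1" and lim: "filterlim \<theta> (at_left 1) sequentially"
    and F: "free_ultrafilter F"
  shows "Ces_plus \<subseteq> weak_star closure_of (convex hull (S_set \<theta> F))"
proof
  fix f assume f: "f \<in> Ces_plus"
  let ?C = "convex hull (S_set \<theta> F)"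
  have C_sub: "?C \<subseteq> Ces_plus"
    by (intro hull_minimal S_set_subset_Ces_plus convex_Ces_plus \<theta> F)
  show "f \<in> weak_star closure_of ?C"
  proof (rule in_weak_star_closureI, rule ccontr)
    fix X and e :: real
    assume X: "finite X" and e: "0 < e"
      and "\<not> (\<exists>g\<in>?C. \<forall>x\<in>X. \<bar>blinfun_apply g x - blinfun_apply f x\<bar> < e)"
    then have far: "\<exists>x\<in>X. e \<le> \<bar>blinfun_apply g x - blinfun_apply f x\<bar>" if "g \<in> ?C" for g
      using that not_less by blast
    have ne: "?C \<noteq> {}" using F by (auto simp: S_set_def)
    have bound: "\<bar>blinfun_apply g x\<bar> \<le> norm x" if "g \<in> ?C" for g x
      using Ces_plus_abs_le that C_sub by blast
    obtain y c where y: "\<And>g. g \<in> ?C \<Longrightarrow> blinfun_apply g y \<le> c" "c < blinfun_apply f y"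
      by (rule weak_star_separation[OF convex_convex_hull ne X e bound far]) (blast+)
    have "f_fun \<theta> F G y \<le> c" if G: "free_ultrafilter G" for G
    proof -
      have "Blinfun (f_fun \<theta> F G) \<in> ?C" using G by (auto simp: S_set_def intro!: hull_inc)
      from y(1)[OF this] show ?thesis
        by (simp add: bounded_linear_Blinfun_apply[OF bounded_linear_f_fun[OF \<theta> F G]])
    qed
    then have "blinfun_apply f y \<le> c" by (rule Ces_plus_le_if_f_fun_le[OF \<theta> lim F f])
    then show False using y(2) by simp
  qed
qed

section \<open>Extreme points and the conclusion\<close>

text \<open>
  Milman's argument: if \<open>f\<close> were not in the closure of \<open>S\<close>, finitely many compact convex sets
  avoiding \<open>f\<close> would cover \<open>S\<close>; as \<open>f\<close> is extreme, the (compact) convex hull of their union would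
  avoid \<open>f\<close> as well.
\<close>

lemma extreme_point_in_weak_star_closure:
  fixes K S :: "linfty_dual set"
  assumes K: "compactin weak_star K" "convex K" and S: "S \<subseteq> K"
    and dense: "K \<subseteq> weak_star closure_of (convex hull S)" and f: "f extreme_point_of K"
  shows "f \<in> weak_star closure_of S"
proof (rule in_weak_star_closureI, rule ccontr)
  fix X and e :: real
  assume X: "finite X" and e: "0 < e"
    and "\<not> (\<exists>g\<in>S. \<forall>x\<in>X. \<bar>blinfun_apply g x - blinfun_apply f x\<bar> < e)"
  then have far: "\<exists>x\<in>X. e \<le> \<bar>blinfun_apply g x - blinfun_apply f x\<bar>" if "g \<in> S" for g
    using that not_less by blast
  \<comment> \<open>Including negatives turns each two-sided deviation from f into a single half
    space.\<close>
  define Y where "Y = X \<union> uminus ` X"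
  define L where "L y = K \<inter> {g. blinfun_apply f y + e \<le> blinfun_apply g y}" for y
  let ?H = "convex hull (\<Union>y\<in>Y. L y)"
  have "compactin weak_star ?H"
    unfolding L_def using X
    by (intro compactin_convex_hull_UN compact_Int_closedin K(1) closedin_weak_star_half_space
        convex_Int K(2) convex_half_space) (simp add: Y_def)
  then have closed: "closedin weak_star ?H" by (rule compactin_imp_closedin[OF Hausdorff_weak_star])
  have "S \<subseteq> (\<Union>y\<in>Y. L y)"
  proof
    fix g assume g: "g \<in> S"
    then obtain x where x: "x \<in> X" "e \<le> \<bar>blinfun_apply g x - blinfun_apply f x\<bar>" using far by blast
    then have "g \<in> L x \<or> g \<in> L (- x)" using g S by (auto simp: L_def blinfun.minus_right)
    then show "g \<in> (\<Union>y\<in>Y. L y)" using x(1) by (auto simp: Y_def)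
  qed
  then have "convex hull S \<subseteq> ?H" by (rule hull_mono)
  then have "K \<subseteq> ?H" using closure_of_minimal[OF _ closed] dense by blast
  moreover have "?H \<subseteq> K - {f}"
  proof (rule hull_minimal)
    show "(\<Union>y\<in>Y. L y) \<subseteq> K - {f}" using e by (auto simp: L_def)
    \<comment> \<open>Extremality enters here: removing an extreme point leaves a convex
      set.\<close>
    show "convex (K - {f})" using f K(2) by (simp add: extreme_point_of_stillconvex)
  qed
  ultimately show False using f by (auto simp: extreme_point_of_def)
qed

theorem theorem6p5:
  fixes \<theta> :: "nat \<Rightarrow> real" and F :: "nat filter"
  assumes "\<And>k. 0 < \<theta> k \<and> \<theta> k < 1"
    and "filterlim \<theta> (at_left 1) sequentially"
    and "free_ultrafilter F"
  shows "weak_star closure_of (convex hull (S_set \<theta> F)) = Ces_plus \<and>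
         (\<forall>f. f extreme_point_of Ces_plus \<longrightarrow> f \<in> weak_star closure_of (S_set \<theta> F))"
proof (intro conjI allI impI equalityI)
  note S_sub = S_set_subset_Ces_plus[OF assms(1,3)]
  note dense = Ces_plus_subset_closure_convex_hull[OF assms]
  show "weak_star closure_of (convex hull (S_set \<theta> F)) \<subseteq> Ces_plus"
    by (intro closure_of_minimal hull_minimal S_sub convex_Ces_plus closedin_Ces_plus)
  show "Ces_plus \<subseteq> weak_star closure_of (convex hull (S_set \<theta> F))" by (rule dense)
  show "f \<in> weak_star closure_of (S_set \<theta> F)" if "f extreme_point_of Ces_plus" for f
    by (rule extreme_point_in_weak_star_closure[OF compactin_Ces_plus convex_Ces_plus S_sub dense that])
qed

end
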